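(* Let $\ell=1$, let $(u_n^0)_{n\ge 2}$ satisfy $u_n^0\ge 0$, $\sum_{n\ge 2}u_n^0=1$, $u_n^0=0$ for all sufficiently large $n$, and $u_2^0>0$. Let $u=(u_2,u_3,\dots)$ be the pre-gelation large-cluster solution on $[0,T]$ ($T>0$) with initial conditions $u_n(0)=u_n^0$. Then for every $n\ge 2$ there are real constants $a_j^{(n)}$, $2n\le j\le 3n-2$, such that on $[0,T]$ $$u_n(t) = \sum_{j =2n}^{3n-2}a_{j}^{(n)}\,m_1(t)^j .$$ Furthermore, $a_{2n}^{(n)}$ and $(-1)^na_{3n-2}^{(n)}$ are both positive.
   Context: Here $m_1(t)=\sum_{i\ge 2} i u_i(t)$. For $\ell=1$, a large-cluster solution on $[0,T]$ is a sequence of nonnegative functions $u_k\in C^1([0,T],[0,1])$, $k\ge 2$, satisfying $$\dot u_n = \sum_{i = 2}^{n-1} \frac{i(n+1-i)}{m_1(t)^2}u_i u_{n+1 - i} - \frac{2nu_n}{m_1(t)},\qquad n\ge 2$$ (empty sum for $n=2$; $0<m_1(t)<\infty$) together with the initial conditions. It is a pre-gelation solution if the series $m_2(t)=\sum_i i^2u_i(t)$ converges uniformly for $t\in[0,T]$. *)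

theory Defs
  imports "HOL-Analysis.Analysis"
begin

text \<open>
  A family of functions is a map \<open>u :: nat \<Rightarrow> real \<Rightarrow> real\<close>, where \<open>u n t\<close> stands for
  $u_n(t)$. Only the indices \<open>n \<ge> 2\<close> and the times \<open>t \<in> {0..T}\<close> are ever constrained
  or used.
\<close>

definition m1 :: "(nat \<Rightarrow> real \<Rightarrow> real) \<Rightarrow> real \<Rightarrow> real" where
  "m1 u t = (\<Sum>\<^sub>\<infinity>i\<in>{2..}. real i * u i t)"

text \<open>
  Derivatives at the end points of the interval are one-sided, so
  \<open>C1_differentiable_on\<close> (which takes derivatives with respect to \<open>at x\<close>) is not
  the right notion here.
\<close>

definition C1_on_interval :: "real \<Rightarrow> (real \<Rightarrow> real) \<Rightarrow> bool" where
  "C1_on_interval T f \<longleftrightarrow>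
     (\<exists>D. continuous_on {0..T} D \<and>
          (\<forall>t\<in>{0..T}. (f has_real_derivative D t) (at t within {0..T})))"

text \<open>
  The summability clause expresses \<open>m1 u t < \<infinity>\<close>; the terms are nonnegative.
  The natural number subtractions below are never truncated.
\<close>

definition large_cluster_solution ::
  "real \<Rightarrow> (nat \<Rightarrow> real) \<Rightarrow> (nat \<Rightarrow> real \<Rightarrow> real) \<Rightarrow> bool" where
  "large_cluster_solution T u0 u \<longleftrightarrow>
     (\<forall>n\<ge>2. C1_on_interval T (u n) \<and> (\<forall>t\<in>{0..T}. u n t \<in> {0..1})) \<and>
     (\<forall>t\<in>{0..T}. (\<lambda>i. real i * u i t) summable_on {2..} \<and> 0 < m1 u t) \<and>
     (\<forall>n\<ge>2. \<forall>t\<in>{0..T}.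
        (u n has_real_derivative
           (\<Sum>i=2..n - 1. real i * real (n + 1 - i) / (m1 u t)\<^sup>2 * u i t * u (n + 1 - i) t)
             - 2 * real n * u n t / m1 u t)
        (at t within {0..T})) \<and>
     (\<forall>n\<ge>2. u n 0 = u0 n)"

definition pre_gelation_solution ::
  "real \<Rightarrow> (nat \<Rightarrow> real) \<Rightarrow> (nat \<Rightarrow> real \<Rightarrow> real) \<Rightarrow> bool" where
  "pre_gelation_solution T u0 u \<longleftrightarrow>
     large_cluster_solution T u0 u \<and>
     uniformly_convergent_on {0..T} (\<lambda>N t. \<Sum>i=2..N. (real i)\<^sup>2 * u i t)"

end

theory Submission imports Defs begin

text \<open>
  Differentiating $m_1$ termwise and using
  $\sum_{i,j} (i+j-1)\,ij\,u_iu_j = 2m_1m_2 - m_1^2$ gives $\dot m_1 = -1$, so $s = m_1(t)$ may serve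
  as the time variable. The substitution $u_n = s^{2n} v_n(s)$ removes the linear term and leaves
  $v_n' = -\sum_{i+j=n+1} ij\,v_iv_j$, so recursively $v_n$ is a polynomial of degree $n-2$ in $s$
  whose leading coefficient has sign $(-1)^n$. As $v_n(m_1(0)) \ge 0$ and, inductively,
  $v_n' < 0$ on $[0, m_1(0))$ for $n \ge 3$, also $v_n(0) > 0$.
\<close>

section \<open>Uniform convergence of series of nonnegative functions\<close>

text \<open>Each tail of the smaller series lies between 0 and the matching tail of the larger one,
  so it is at least as close to its limit. This carries uniform convergence from the second moment
  to the first.\<close>

lemma uniform_limit_series_dominated:
  fixes a b :: "nat \<Rightarrow> 'a \<Rightarrow> real"
  assumes nonneg: "\<And>i x. x \<in> S \<Longrightarrow> 0 \<le> a i x"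
    and le: "\<And>i x. x \<in> S \<Longrightarrow> a i x \<le> b i x"
    and A: "\<And>x. x \<in> S \<Longrightarrow> (\<lambda>i. a i x) sums A x"
    and B: "uniform_limit S (\<lambda>n x. \<Sum>i<n. b i x) B sequentially"
  shows "uniform_limit S (\<lambda>n x. \<Sum>i<n. a i x) A sequentially"
proof (rule uniform_limitI)
  fix e :: real assume "e > 0"
  have tail: "dist (\<Sum>i<n. a i x) (A x) \<le> dist (\<Sum>i<n. b i x) (B x)" if x: "x \<in> S" for n x
  proof -
    have Bx: "(\<lambda>i. b i x) sums B x"
      using tendsto_uniform_limitI[OF B x] by (simp add: sums_def)
    have a_tail: "(\<lambda>i. a (i + n) x) sums (A x - (\<Sum>i<n. a i x))"
      by (rule sums_split_initial_segment[OF A[OF x]])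
    have b_tail: "(\<lambda>i. b (i + n) x) sums (B x - (\<Sum>i<n. b i x))"
      by (rule sums_split_initial_segment[OF Bx])
    have "0 \<le> A x - (\<Sum>i<n. a i x)"
      by (rule sums_le[OF _ sums_zero a_tail]) (rule nonneg[OF x])
    moreover have "A x - (\<Sum>i<n. a i x) \<le> B x - (\<Sum>i<n. b i x)"
      by (rule sums_le[OF _ a_tail b_tail]) (rule le[OF x])
    ultimately show ?thesis by (simp add: dist_real_def)
  qed
  show "\<forall>\<^sub>F n in sequentially. \<forall>x\<in>S. dist (\<Sum>i<n. a i x) (A x) < e"
    using uniform_limitD[OF B \<open>e > 0\<close>] by eventually_elim (blast intro: le_less_trans[OF tail])
qed

text \<open>The triangular sums lie between the sums over the squares of side \<open>n div 2\<close> and \<open>n\<close>.\<close>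

lemma uniform_limit_triangle_sum:
  fixes c :: "nat \<Rightarrow> nat \<Rightarrow> 'a \<Rightarrow> real"
  assumes nonneg: "\<And>i j x. x \<in> S \<Longrightarrow> 0 \<le> c i j x"
    and L: "uniform_limit S (\<lambda>n x. \<Sum>i<n. \<Sum>j<n. c i j x) L sequentially"
  shows "uniform_limit S (\<lambda>n x. \<Sum>k<n. \<Sum>i\<le>k. c i (k - i) x) L sequentially"
proof (rule uniform_limitI)
  fix e :: real assume "e > 0"
  have square: "(\<Sum>i<n. \<Sum>j<n. c i j x) = (\<Sum>(i,j)\<in>{..<n} \<times> {..<n}. c i j x)" for n x
    by (simp add: sum.cartesian_product)
  have triangle: "(\<Sum>k<n. \<Sum>i\<le>k. c i (k - i) x) = (\<Sum>(i,j)\<in>{(i,j). i + j < n}. c i j x)" for n x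
    by (rule sum.triangle_reindex[symmetric])
  have fin: "finite {(i::nat, j). i + j < n}" for n
    by (rule finite_subset[of _ "{..<n} \<times> {..<n}"]) auto
  have upper: "(\<Sum>k<n. \<Sum>i\<le>k. c i (k - i) x) \<le> (\<Sum>i<n. \<Sum>j<n. c i j x)" if "x \<in> S" for n x
    unfolding square triangle using nonneg[OF that] by (intro sum_mono2) auto
  have lower: "(\<Sum>i<n div 2. \<Sum>j<n div 2. c i j x) \<le> (\<Sum>k<n. \<Sum>i\<le>k. c i (k - i) x)"
    if "x \<in> S" for n x
    unfolding square triangle using nonneg[OF that] fin by (intro sum_mono2) auto
  \<comment> \<open>Along \<open>n div 2\<close> the square sums still tend uniformly to
    \<open>L\<close>, so both bounds of the squeeze have the same limit.\<close>
  have "filterlim (\<lambda>n::nat. n div 2) at_top sequentially"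
    by (rule filterlim_at_top_div_const_nat) simp
  from filterlim_compose[OF L this]
  have L2: "uniform_limit S (\<lambda>n x. \<Sum>i<n div 2. \<Sum>j<n div 2. c i j x) L sequentially" .
  show "\<forall>\<^sub>F n in sequentially. \<forall>x\<in>S. dist (\<Sum>k<n. \<Sum>i\<le>k. c i (k - i) x) (L x) < e"
    using uniform_limitD[OF L \<open>e > 0\<close>] uniform_limitD[OF L2 \<open>e > 0\<close>]
  proof eventually_elim
    case (elim n)
    show ?case
    proof
      fix x assume x: "x \<in> S"
      show "dist (\<Sum>k<n. \<Sum>i\<le>k. c i (k - i) x) (L x) < e"
        using bspec[OF elim(1) x] bspec[OF elim(2) x] upper[OF x, of n] lower[OF x, of n]
        unfolding dist_real_def abs_less_iff by linarith
    qed
  qed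
qed

section \<open>Polynomial antiderivatives, top coefficients and monotonicity\<close>

text \<open>\<open>V0\<close> integrates coefficientwise; a constant shift then adjusts the value at
  \<open>x\<close> and leaves the coefficients of positive index alone. The coefficient formula
  later transfers the sign of the top coefficient from \<open>W\<close> to \<open>V\<close>.\<close>

lemma poly_antiderivative_exists:
  fixes W :: "'a::field_char_0 poly"
  obtains V where "pderiv V = W" "poly V x = c" "degree V \<le> Suc (degree W)"
    "\<And>k. coeff V (Suc k) = coeff W k / of_nat (Suc k)"
proof -
  define V0 where "V0 = (\<Sum>k\<le>degree W. monom (coeff W k / of_nat (Suc k)) (Suc k))"
  define V where "V = V0 + [:c - poly V0 x:]"
  have coeff: "coeff V (Suc k) = coeff W k / of_nat (Suc k)" for k
    by (simp add: V_def V0_def coeff_sum coeff_eq_0)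
  have "pderiv V = W"
    by (rule poly_eqI) (simp add: coeff_pderiv coeff del: of_nat_Suc)
  moreover have "poly V x = c" by (simp add: V_def)
  moreover have "degree V \<le> Suc (degree W)"
    unfolding V_def V0_def
    by (intro degree_add_le degree_sum_le) (auto intro: order.trans[OF degree_monom_le])
  ultimately show thesis using coeff that by blast
qed

text \<open>Upper bounds on the degrees suffice: if one of them is strict, both sides
  vanish.\<close>

lemma coeff_mult_degree_le_sum:
  fixes p q :: "'a::comm_semiring_0 poly"
  assumes "degree p \<le> a" "degree q \<le> b"
  shows "coeff (p * q) (a + b) = coeff p a * coeff q b"
proof (cases "degree p = a \<and> degree q = b")
  case True
  then show ?thesis using coeff_mult_degree_sum[of p q] by auto
next
  case False
  then have "degree p + degree q < a + b" using assms by auto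
  then have "coeff (p * q) (a + b) = 0"
    by (intro coeff_eq_0 le_less_trans[OF degree_mult_le])
  moreover have "coeff p a * coeff q b = 0" using False assms by (auto simp: coeff_eq_0)
  ultimately show ?thesis by simp
qed

lemma poly_eq_sum_le:
  fixes p :: "'a::comm_semiring_1 poly"
  assumes "degree p \<le> n"
  shows "poly p x = (\<Sum>i\<le>n. coeff p i * x ^ i)"
  by (subst poly_as_sum_of_monoms'[OF assms, symmetric]) (simp add: poly_sum poly_monom)

lemma poly_gt_of_pderiv_neg:
  fixes p :: "real poly"
  assumes "a < b" "\<And>x. a < x \<Longrightarrow> x < b \<Longrightarrow> poly (pderiv p) x < 0"
  shows "poly p b < poly p a"
proof -
  obtain x where "a < x" "x < b" "poly p b - poly p a = (b - a) * poly (pderiv p) x"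
    using poly_MVT[OF assms(1)] by blast
  moreover from this have "(b - a) * poly (pderiv p) x < 0"
    using assms by (intro mult_pos_neg) auto
  ultimately show ?thesis by linarith
qed

section \<open>The first moment decreases at unit speed\<close>

text \<open>Termwise differentiation requires uniform convergence of the series of derivatives. Its
  loss part is the second-moment series times a bounded function; its gain part is a double series
  summed along diagonals, whose square partial sums are polynomials in the partial sums of the first
  and second moments.\<close>

lemma m1_has_derivative:
  assumes sol: "pre_gelation_solution T u0 u" and t: "t \<in> {0..T}"
  shows "(m1 u has_real_derivative -1) (at t within {0..T})"
proof -
  let ?S = "{0..T}"
  have u_nonneg: "0 \<le> u n x" if "n \<ge> 2" "x \<in> ?S" for n x
    using sol that unfolding pre_gelation_solution_def large_cluster_solution_def by auto
  have m1_pos: "0 < m1 u x" and m1_summable: "(\<lambda>i. real i * u i x) summable_on {2..}"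
    if "x \<in> ?S" for x
    using sol that unfolding pre_gelation_solution_def large_cluster_solution_def by auto
  have ode: "(u n has_real_derivative
      (\<Sum>i=2..n - 1. real i * real (n + 1 - i) / (m1 u x)\<^sup>2 * u i x * u (n + 1 - i) x)
        - 2 * real n * u n x / m1 u x) (at x within ?S)" if "n \<ge> 2" "x \<in> ?S" for n x
    using sol that unfolding pre_gelation_solution_def large_cluster_solution_def by blast
  \<comment> \<open>Setting the terms with index 0 and 1 to zero lets all series start at 0 and all
    diagonals be summed in full.\<close>
  define p where "p i x = (if 2 \<le> i then real i * u i x else 0)" for i x
  have p_nonneg: "0 \<le> p i x" if "x \<in> ?S" for i x
    using u_nonneg that by (simp add: p_def)
  define P Q where "P n x = (\<Sum>i<n. p i x)" and "Q n x = (\<Sum>i<n. real i * p i x)"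
    for n :: nat and x
  have p_sums: "(\<lambda>i. p i x) sums m1 u x" if "x \<in> ?S" for x
  proof -
    have "((\<lambda>i. real i * u i x) has_sum m1 u x) {2..}"
      unfolding m1_def using m1_summable[OF that] by (rule has_sum_infsum)
    then have "((\<lambda>i. p i x) has_sum m1 u x) UNIV"
      by (rule has_sum_cong_neutral[THEN iffD1, rotated -1]) (auto simp: p_def)
    then show ?thesis by (rule has_sum_imp_sums)
  qed
  obtain q where "uniform_limit ?S (\<lambda>N x. \<Sum>i=2..N. (real i)\<^sup>2 * u i x) q sequentially"
    using sol unfolding pre_gelation_solution_def uniformly_convergent_on_def by blast
  moreover have "(\<Sum>i=2..N. (real i)\<^sup>2 * u i x) = Q (Suc N) x" for N x
    unfolding Q_def lessThan_Suc_atMost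
    by (rule sum.mono_neutral_cong_left) (auto simp: p_def power2_eq_square)
  ultimately have Q_lim: "uniform_limit ?S Q q sequentially"
    by (simp add: filterlim_sequentially_Suc)
  have P_lim: "uniform_limit ?S P (m1 u) sequentially"
    unfolding P_def using Q_lim[unfolded Q_def]
  proof (rule uniform_limit_series_dominated[OF p_nonneg _ p_sums, rotated -1])
    show "p i x \<le> real i * p i x" if "x \<in> ?S" for i x
      using mult_right_mono[OF _ p_nonneg[OF that, of i], of 1 "real i"]
      by (cases "2 \<le> i") (auto simp: p_def)
  qed
  have cont_p: "continuous_on ?S (p i)" for i
  proof (cases "2 \<le> i")
    case True
    have "continuous_on ?S (u i)"
      using DERIV_continuous[OF ode[OF True]] unfolding continuous_on_eq_continuous_within by blast
    then show ?thesis using True by (auto simp: p_def fun_eq_iff intro!: continuous_intros)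
  qed (simp add: p_def)
  have cont_m1: "continuous_on ?S (m1 u)"
    by (rule uniform_limit_theorem[OF always_eventually P_lim])
       (auto simp: P_def intro!: continuous_intros cont_p)
  have cont_q: "continuous_on ?S q"
    by (rule uniform_limit_theorem[OF always_eventually Q_lim])
       (auto simp: Q_def intro!: continuous_intros cont_p)
  \<comment> \<open>Products preserve uniform limits when the limit functions are bounded; here
    boundedness comes from continuity on a compact interval.\<close>
  have bdd: "bounded (f ` ?S)" if "continuous_on ?S f" for f :: "real \<Rightarrow> real"
    using that by (intro compact_imp_bounded compact_continuous_image) auto
  define r where "r x = inverse (m1 u x)" for x
  have cont_r: "continuous_on ?S r"
    unfolding r_def using m1_pos by (intro continuous_intros cont_m1) force
  note conts = cont_m1 cont_q cont_r
  \<comment> \<open>On the diagonal i + j = n + 1 the weight is n, so \<open>c i j x\<close> is, up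
    to the factor \<open>1 / (m1 u x)\<^sup>2\<close>, the contribution of the pair to the gain in
    the derivative of n u_n.\<close>
  define c where "c i j x = (real i + real j - 1) * (p i x * p j x)" for i j x
  have c_nonneg: "0 \<le> c i j x" if "x \<in> ?S" for i j x
    using p_nonneg[OF that, of i] p_nonneg[OF that, of j]
    by (cases "2 \<le> i") (auto simp: c_def p_def)
  have square: "(\<Sum>i<n. \<Sum>j<n. c i j x) = 2 * (Q n x * P n x) - P n x * P n x" for n x
  proof -
    have "(\<Sum>i<n. \<Sum>j<n. c i j x)
        = (\<Sum>i<n. \<Sum>j<n. (real i * p i x) * p j x + p i x * (real j * p j x) - p i x * p j x)"
      by (simp add: c_def algebra_simps)
    also have "\<dots> = Q n x * P n x + P n x * Q n x - P n x * P n x"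
      by (simp add: sum.distrib sum_subtractf P_def Q_def sum_product)
    finally show ?thesis by simp
  qed
  have "uniform_limit ?S (\<lambda>n x. \<Sum>i<n. \<Sum>j<n. c i j x)
      (\<lambda>x. 2 * (q x * m1 u x) - m1 u x * m1 u x) sequentially"
    unfolding square
    by (intro uniform_limit_intros uniform_lim_mult Q_lim P_lim bdd conts continuous_intros)
  \<comment> \<open>The diagonal i + j = k + 1 feeds size k, hence the index shift by one; the
    diagonal split off, i + j = 0, contributes zero.\<close>
  from uniform_limit_triangle_sum[OF c_nonneg this]
  have "uniform_limit ?S (\<lambda>n x. \<Sum>k<Suc n. \<Sum>i\<le>k. c i (k - i) x)
      (\<lambda>x. 2 * (q x * m1 u x) - m1 u x * m1 u x) sequentially"
    by (subst filterlim_sequentially_Suc)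
  then have C_lim: "uniform_limit ?S (\<lambda>n x. \<Sum>k<n. \<Sum>i\<le>Suc k. c i (Suc k - i) x)
      (\<lambda>x. 2 * (q x * m1 u x) - m1 u x * m1 u x) sequentially"
    unfolding sum.lessThan_Suc_shift by (simp add: c_def p_def)
  define D where
    "D n x = (\<Sum>i\<le>Suc n. c i (Suc n - i) x) * (r x * r x) - 2 * (real n * p n x * r x)" for n x
  have p_deriv: "(p n has_real_derivative D n x) (at x within ?S)" if x: "x \<in> ?S" for n x
  proof (cases "2 \<le> n")
    case True
    have "(\<Sum>i=2..n - 1. real i * real (n + 1 - i) / (m1 u x)\<^sup>2 * u i x * u (n + 1 - i) x) * real n
        = (\<Sum>i=2..n - 1. c i (Suc n - i) x * (r x * r x))"
      unfolding sum_distrib_right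
    proof (rule sum.cong)
      fix i assume i: "i \<in> {2..n - 1}"
      then have "real i + real (Suc n - i) - 1 = real n" "2 \<le> Suc n - i" by auto
      then show "real i * real (n + 1 - i) / (m1 u x)\<^sup>2 * u i x * u (n + 1 - i) x * real n
          = c i (Suc n - i) x * (r x * r x)"
        using i by (simp add: c_def p_def r_def field_simps power2_eq_square)
    qed simp
    \<comment> \<open>For each added \<open>i\<close>, either \<open>i\<close> or
      \<open>Suc n - i\<close> is below 2, so the term vanishes.\<close>
    also have "\<dots> = (\<Sum>i\<le>Suc n. c i (Suc n - i) x * (r x * r x))"
      by (rule sum.mono_neutral_left) (auto simp: c_def p_def)
    also have "\<dots> = (\<Sum>i\<le>Suc n. c i (Suc n - i) x) * (r x * r x)"
      by (simp only: sum_distrib_right)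
    finally have gain: "(\<Sum>i=2..n - 1. real i * real (n + 1 - i) / (m1 u x)\<^sup>2
        * u i x * u (n + 1 - i) x) * real n = \<dots>" .
    have "((\<Sum>i=2..n - 1. real i * real (n + 1 - i) / (m1 u x)\<^sup>2 * u i x * u (n + 1 - i) x)
          - 2 * real n * u n x / m1 u x) * real n = D n x"
      unfolding left_diff_distrib gain D_def using True by (simp add: p_def r_def divide_inverse)
    then have "((\<lambda>x. u n x * real n) has_real_derivative D n x) (at x within ?S)"
      using DERIV_cmult_right[OF ode[OF True x], of "real n"] by simp
    moreover have "p n = (\<lambda>x. u n x * real n)" using True by (auto simp: p_def)
    ultimately show ?thesis by simp
  next
    case False
    then have "p n = (\<lambda>_. 0)" "D n x = 0" by (auto simp: p_def D_def c_def not_le less_Suc_eq)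
    then show ?thesis by simp
  qed
  have "uniform_limit ?S (\<lambda>n x. (\<Sum>k<n. \<Sum>i\<le>Suc k. c i (Suc k - i) x) * (r x * r x)
        - 2 * (Q n x * r x))
      (\<lambda>x. (2 * (q x * m1 u x) - m1 u x * m1 u x) * (r x * r x) - 2 * (q x * r x)) sequentially"
    by (intro uniform_limit_intros uniform_lim_mult Q_lim C_lim bdd conts continuous_intros)
  moreover have "(\<Sum>k<n. \<Sum>i\<le>Suc k. c i (Suc k - i) x) * (r x * r x) - 2 * (Q n x * r x)
      = (\<Sum>k<n. D k x)" for n x
    by (simp only: D_def Q_def sum_subtractf sum_distrib_left sum_distrib_right)
  ultimately have "uniform_limit ?S (\<lambda>n x. \<Sum>k<n. D k x)
      (\<lambda>x. (2 * (q x * m1 u x) - m1 u x * m1 u x) * (r x * r x) - 2 * (q x * r x)) sequentially"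
    by simp
  from has_field_derivative_series[OF _ p_deriv this t sums_summable[OF p_sums[OF t]]]
  obtain g where g: "\<And>x. x \<in> ?S \<Longrightarrow> (\<lambda>n. p n x) sums g x"
    "(g has_real_derivative
      (2 * (q t * m1 u t) - m1 u t * m1 u t) * (r t * r t) - 2 * (q t * r t)) (at t within ?S)"
    using t by blast
  have "g x = m1 u x" if "x \<in> ?S" for x
    using sums_unique2[OF g(1)[OF that] p_sums[OF that]] .
  \<comment> \<open>Since \<open>r t\<close> is the reciprocal of \<open>m1 u t\<close>, the
    second-moment terms of gain and loss cancel.\<close>
  moreover have "(2 * (q t * m1 u t) - m1 u t * m1 u t) * (r t * r t) - 2 * (q t * r t) = -1"
    using m1_pos[OF t] by (simp add: r_def field_simps)
  ultimately show ?thesis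
    using has_field_derivative_transform_within[OF g(2) zero_less_one t] by simp
qed

section \<open>Polynomial form of the rescaled cluster densities\<close>

text \<open>Positivity at 0 alone would not pass through the induction: the sign of the next
  derivative is needed on the whole interval from 0 to \<open>m1 u 0\<close>. The right end is
  excluded because the polynomial vanishes there whenever \<open>u0 n = 0\<close>.\<close>

lemma cluster_polynomial_exists:
  assumes sol: "pre_gelation_solution T u0 u" and T: "T \<ge> 0"
    and u0_nonneg: "\<And>n. n \<ge> 2 \<Longrightarrow> u0 n \<ge> 0" and u0_2: "u0 2 > 0"
    and n: "n \<ge> 2"
  shows "\<exists>V. (\<forall>t\<in>{0..T}. u n t = m1 u t ^ (2 * n) * poly V (m1 u t)) \<and>
    degree V \<le> n - 2 \<and> (-1) ^ n * coeff V (n - 2) > 0 \<and>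
    (\<forall>s. 0 \<le> s \<longrightarrow> s < m1 u 0 \<longrightarrow> poly V s > 0)"
  using n
proof (induction n rule: less_induct)
  case (less n)
  let ?S = "{0..T}"
  have m1_pos: "0 < m1 u x" if "x \<in> ?S" for x
    using sol that unfolding pre_gelation_solution_def large_cluster_solution_def by auto
  have init: "u n 0 = u0 n"
    using sol less.prems unfolding pre_gelation_solution_def large_cluster_solution_def by auto
  have ode: "(u n has_real_derivative
      (\<Sum>i=2..n - 1. real i * real (n + 1 - i) / (m1 u x)\<^sup>2 * u i x * u (n + 1 - i) x)
        - 2 * real n * u n x / m1 u x) (at x within ?S)" if "x \<in> ?S" for x
    using sol that less.prems unfolding pre_gelation_solution_def large_cluster_solution_def
    by blast
  from less.IH have "\<forall>i\<in>{2..<n}. \<exists>V.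
    (\<forall>t\<in>{0..T}. u i t = m1 u t ^ (2 * i) * poly V (m1 u t)) \<and>
    degree V \<le> i - 2 \<and> (-1) ^ i * coeff V (i - 2) > 0 \<and>
    (\<forall>s. 0 \<le> s \<longrightarrow> s < m1 u 0 \<longrightarrow> poly V s > 0)"
    by auto
  then obtain V where V: "\<And>i. i \<in> {2..<n} \<Longrightarrow>
    (\<forall>t\<in>{0..T}. u i t = m1 u t ^ (2 * i) * poly (V i) (m1 u t)) \<and>
    degree (V i) \<le> i - 2 \<and> (-1) ^ i * coeff (V i) (i - 2) > 0 \<and>
    (\<forall>s. 0 \<le> s \<longrightarrow> s < m1 u 0 \<longrightarrow> poly (V i) s > 0)"
    by (metis (lifting))
  \<comment> \<open>\<open>W\<close> is the right-hand side of the equation for v_n in the variable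
    s. Both indices of each product lie in \<open>{2..<n}\<close>, so the induction hypothesis
    applies to them. \<open>Vn\<close> integrates \<open>W\<close> and takes the initial value of
    v_n at s = \<open>m1 u 0\<close>.\<close>
  define W where
    "W = - (\<Sum>i=2..n - 1. smult (real i * real (n + 1 - i)) (V i * V (n + 1 - i)))"
  obtain Vn where Vn: "pderiv Vn = W" "poly Vn (m1 u 0) = u0 n / m1 u 0 ^ (2 * n)"
      "degree Vn \<le> Suc (degree W)" "\<And>k. coeff Vn (Suc k) = coeff W k / real (Suc k)"
    using poly_antiderivative_exists[of W "m1 u 0" "u0 n / m1 u 0 ^ (2 * n)"] by blast
  have range: "i \<in> {2..<n}" "n + 1 - i \<in> {2..<n}" if "i \<in> {2..n - 1}" for i
    using that by auto
  \<comment> \<open>Differentiating in t avoids inverting \<open>m1 u\<close>. As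
    \<open>m1 u\<close> has derivative -1, the loss term cancels against the derivative of the
    denominator, and the remaining gain cancels against the derivative of
    \<open>poly Vn (m1 u x)\<close>.\<close>
  have "((\<lambda>x. u n x / m1 u x ^ (2 * n) - poly Vn (m1 u x)) has_real_derivative 0) (at x within ?S)"
    if x: "x \<in> ?S" for x
  proof -
    let ?m = "m1 u x"
    note m = m1_pos[OF x]
    have "(\<Sum>i=2..n - 1. real i * real (n + 1 - i) / ?m\<^sup>2 * u i x * u (n + 1 - i) x)
        = - (?m ^ (2 * n) * poly W ?m)"
      unfolding W_def poly_minus poly_sum mult_minus_right minus_minus sum_distrib_left
    proof (rule sum.cong)
      fix i assume i: "i \<in> {2..n - 1}"
      \<comment> \<open>The two surplus powers of \<open>?m\<close> cancel the division by
        \<open>?m\<^sup>2\<close>.\<close>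
      then have "2 * n + 2 = 2 * i + 2 * (n + 1 - i)" by auto
      then have "?m ^ (2 * i) * ?m ^ (2 * (n + 1 - i)) = ?m ^ (2 * n) * ?m\<^sup>2"
        by (simp flip: power_add)
      moreover have "u i x = ?m ^ (2 * i) * poly (V i) ?m"
        "u (n + 1 - i) x = ?m ^ (2 * (n + 1 - i)) * poly (V (n + 1 - i)) ?m"
        using V[OF range(1)[OF i]] V[OF range(2)[OF i]] x by auto
      then have "real i * real (n + 1 - i) / ?m\<^sup>2 * u i x * u (n + 1 - i) x
        = real i * real (n + 1 - i) / ?m\<^sup>2 * (?m ^ (2 * i) * ?m ^ (2 * (n + 1 - i)))
            * (poly (V i) ?m * poly (V (n + 1 - i)) ?m)"
        by (simp only: mult_ac)
      ultimately have "real i * real (n + 1 - i) / ?m\<^sup>2 * u i x * u (n + 1 - i) x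
        = real i * real (n + 1 - i) / ?m\<^sup>2 * (?m ^ (2 * n) * ?m\<^sup>2)
            * (poly (V i) ?m * poly (V (n + 1 - i)) ?m)"
        by (simp only:)
      then show "real i * real (n + 1 - i) / ?m\<^sup>2 * u i x * u (n + 1 - i) x
        = ?m ^ (2 * n) * poly (smult (real i * real (n + 1 - i)) (V i * V (n + 1 - i))) ?m"
        using m by simp
    qed simp
    then have du: "(u n has_real_derivative - (?m ^ (2 * n) * poly W ?m) - 2 * real n * u n x / ?m)
        (at x within ?S)"
      using ode[OF x] by simp
    have dm: "(m1 u has_real_derivative -1) (at x within ?S)"
      by (rule m1_has_derivative[OF sol x])
    have eq: "((- (?m ^ (2 * n) * poly W ?m) - 2 * real n * u n x / ?m) * ?m ^ (2 * n)
        - u n x * (real (2 * n) * (-1 * ?m ^ (2 * n - Suc 0)))) / (?m ^ (2 * n) * ?m ^ (2 * n))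
        - poly (pderiv Vn) ?m * -1 = 0"
    proof -
      have "?m ^ (2 * n) = ?m * ?m ^ (2 * n - Suc 0)"
        using less.prems by (simp flip: power_Suc)
      then show ?thesis using m Vn(1) by (simp add: field_simps)
    qed
    have "((\<lambda>x. u n x / m1 u x ^ (2 * n) - poly Vn (m1 u x)) has_real_derivative
      ((- (?m ^ (2 * n) * poly W ?m) - 2 * real n * u n x / ?m) * ?m ^ (2 * n)
        - u n x * (real (2 * n) * (-1 * ?m ^ (2 * n - Suc 0)))) / (?m ^ (2 * n) * ?m ^ (2 * n))
        - poly (pderiv Vn) ?m * -1) (at x within ?S)"
      using m by (intro DERIV_diff DERIV_divide DERIV_power DERIV_chain2[OF poly_DERIV] du dm) auto
    then show ?thesis unfolding eq .
  qed
  from has_field_derivative_zero_constant[OF convex_closed_interval this]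
  obtain c where c: "\<And>x. x \<in> ?S \<Longrightarrow> u n x / m1 u x ^ (2 * n) - poly Vn (m1 u x) = c"
    by blast
  have "c = 0" using c[of 0] T Vn(2) init by simp
  then have rep: "u n x = m1 u x ^ (2 * n) * poly Vn (m1 u x)" if "x \<in> ?S" for x
    using c[OF that] m1_pos[OF that] by (simp add: field_simps)
  \<comment> \<open>The indices add up to n + 1, so each product has a top coefficient of sign
    (-1)^(n+1); the minus sign in \<open>W\<close> turns this into (-1)^n.\<close>
  have W_term: "degree (V i * V (n + 1 - i)) \<le> n - 3 \<and>
      (-1) ^ n * coeff (V i * V (n + 1 - i)) (n - 3) < 0" if i: "i \<in> {2..n - 1}" for i
  proof -
    note Vi = V[OF range(1)[OF i]] and Vj = V[OF range(2)[OF i]]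
    have deg: "(i - 2) + (n + 1 - i - 2) = n - 3" using i by auto
    have "degree (V i * V (n + 1 - i)) \<le> n - 3"
      using Vi Vj degree_mult_le[of "V i" "V (n + 1 - i)"] deg by linarith
    moreover have coeff: "coeff (V i * V (n + 1 - i)) (n - 3)
        = coeff (V i) (i - 2) * coeff (V (n + 1 - i)) (n + 1 - i - 2)"
      using coeff_mult_degree_le_sum[of "V i" "i - 2" "V (n + 1 - i)" "n + 1 - i - 2"] Vi Vj deg
      by simp
    have sign: "(-1::real) ^ n = - ((-1) ^ i * (-1) ^ (n + 1 - i))"
    proof -
      have "i + (n + 1 - i) = Suc n" using i by auto
      then show ?thesis by (simp flip: power_add)
    qed
    have "0 < ((-1) ^ i * coeff (V i) (i - 2))
        * ((-1) ^ (n + 1 - i) * coeff (V (n + 1 - i)) (n + 1 - i - 2))"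
      by (rule mult_pos_pos) (use Vi Vj in \<open>blast+\<close>)
    then have "(-1) ^ n * coeff (V i * V (n + 1 - i)) (n - 3) < 0"
      unfolding coeff sign by (simp only: mult_minus_left mult_minus_right neg_less_0_iff_less mult_ac)
    ultimately show ?thesis by blast
  qed
  have props: "degree Vn \<le> n - 2 \<and> (-1) ^ n * coeff Vn (n - 2) > 0 \<and>
    (\<forall>s. 0 \<le> s \<longrightarrow> s < m1 u 0 \<longrightarrow> poly Vn s > 0)"
  \<comment> \<open>For n = 2 the gain sum is empty and \<open>Vn\<close> is the constant
    \<open>u0 2 / m1 u 0 ^ 4\<close>, positive by \<open>u0_2\<close>.\<close>
  proof (cases "n = 2")
    case True
    then have "W = 0" by (simp add: W_def)
    then have "degree Vn = 0" using Vn(1) by (simp add: pderiv_eq_0_iff)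
    then obtain a where a: "Vn = [:a:]" by (rule degree_eq_zeroE)
    then have "a > 0" using Vn(2) True u0_2 m1_pos[of 0] T by simp
    then show ?thesis using a True by simp
  next
    case False
    with less.prems have n3: "n \<ge> 3" by simp
    then have Suc: "n - 2 = Suc (n - 3)" by simp
    have "degree W \<le> n - 3"
      unfolding W_def degree_minus
      by (intro degree_sum_le) (use W_term in \<open>auto intro: order.trans[OF degree_smult_le]\<close>)
    then have "degree Vn \<le> n - 2" using Vn(3) Suc by linarith
    moreover have "(-1) ^ n * coeff Vn (n - 2) > 0"
    proof -
      \<comment> \<open>All summands have the same sign and there is at least one, so the top
        coefficients cannot cancel.\<close>
      have "(-1) ^ n * coeff W (n - 3) = (\<Sum>i=2..n - 1. real i * real (n + 1 - i) *
          - ((-1) ^ n * coeff (V i * V (n + 1 - i)) (n - 3)))"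
        by (simp add: W_def coeff_sum sum_distrib_left sum_negf mult_ac)
      also have "\<dots> > 0"
        using W_term n3 by (intro sum_pos mult_pos_pos) auto
      finally show ?thesis unfolding Suc Vn(4) by (simp add: field_simps)
    qed
    \<comment> \<open>Strict decrease up to \<open>m1 u 0\<close>, where the value is only known to
      be nonnegative, makes every earlier value strictly positive.\<close>
    moreover have "poly Vn s > 0" if s: "0 \<le> s" "s < m1 u 0" for s
    proof -
      have "poly (pderiv Vn) x < 0" if x: "s < x" "x < m1 u 0" for x
      proof -
        have "0 < (\<Sum>i=2..n - 1. real i * real (n + 1 - i) *
            (poly (V i) x * poly (V (n + 1 - i)) x))"
          using V range n3 s x by (intro sum_pos mult_pos_pos) auto
        then show ?thesis by (simp add: Vn(1) W_def poly_sum)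
      qed
      then have "poly Vn (m1 u 0) < poly Vn s" by (intro poly_gt_of_pderiv_neg s)
      moreover have "poly Vn (m1 u 0) \<ge> 0"
        using Vn(2) u0_nonneg[OF less.prems] m1_pos[of 0] T by simp
      ultimately show ?thesis by simp
    qed
    ultimately show ?thesis by blast
  qed
  show ?case using rep props by blast
qed

section \<open>Reading off the coefficients\<close>

theorem theorem16:
  fixes T :: real and u0 :: "nat \<Rightarrow> real" and u :: "nat \<Rightarrow> real \<Rightarrow> real"
  assumes "T > 0"
    and "\<forall>n\<ge>2. u0 n \<ge> 0"
    and "(u0 has_sum 1) {2..}"
    and "\<forall>\<^sub>F n in sequentially. u0 n = 0"
    and "u0 2 > 0"
    and "pre_gelation_solution T u0 u"
  shows "\<forall>n\<ge>2. \<exists>a :: nat \<Rightarrow> real.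
           (\<forall>t\<in>{0..T}. u n t = (\<Sum>j=2*n..3*n - 2. a j * m1 u t ^ j)) \<and>
           a (2*n) > 0 \<and> (-1) ^ n * a (3*n - 2) > 0"
proof (intro allI impI)
  fix n :: nat assume n: "n \<ge> 2"
  obtain V where V: "\<And>t. t \<in> {0..T} \<Longrightarrow> u n t = m1 u t ^ (2 * n) * poly V (m1 u t)"
    "degree V \<le> n - 2" "(-1) ^ n * coeff V (n - 2) > 0"
    "\<And>s. 0 \<le> s \<Longrightarrow> s < m1 u 0 \<Longrightarrow> poly V s > 0"
    using cluster_polynomial_exists[OF assms(6) less_imp_le[OF assms(1)] _ assms(5) n] assms(2)
    by blast
  \<comment> \<open>The factor \<open>m1 u t ^ (2 * n)\<close> shifts exponents by 2n, so the
    constant coefficient of \<open>V\<close> becomes \<open>a (2 * n)\<close> and the one at n - 2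
    becomes \<open>a (3 * n - 2)\<close>.\<close>
  define a where "a j = coeff V (j - 2 * n)" for j
  have "u n t = (\<Sum>j=2*n..3*n - 2. a j * m1 u t ^ j)" if "t \<in> {0..T}" for t
  proof -
    have "(\<Sum>j=2*n..3*n - 2. a j * m1 u t ^ j)
        = (\<Sum>i\<le>n - 2. coeff V i * m1 u t ^ (i + 2 * n))"
      using n by (intro sum.reindex_bij_witness[of _ "\<lambda>i. i + 2 * n" "\<lambda>j. j - 2 * n"])
        (auto simp: a_def)
    also have "\<dots> = m1 u t ^ (2 * n) * poly V (m1 u t)"
      by (simp add: poly_eq_sum_le[OF V(2)] sum_distrib_left power_add mult_ac)
    finally show ?thesis using V(1)[OF that] by simp
  qed
  moreover have "a (2 * n) > 0"
  proof -
    \<comment> \<open>This places 0 inside the interval on which \<open>V\<close> is positive, and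
      the value of \<open>V\<close> at 0 is its constant coefficient.\<close>
    have "0 < m1 u 0"
      using assms(1,6) unfolding pre_gelation_solution_def large_cluster_solution_def by auto
    then show ?thesis using V(4)[of 0] by (simp add: a_def poly_0_coeff_0)
  qed
  moreover have "(-1) ^ n * a (3 * n - 2) > 0"
    using V(3) n by (simp add: a_def diff_diff_left[symmetric] diff_commute)
  ultimately show "\<exists>a. (\<forall>t\<in>{0..T}. u n t = (\<Sum>j=2*n..3*n - 2. a j * m1 u t ^ j)) \<and>
      a (2*n) > 0 \<and> (-1) ^ n * a (3*n - 2) > 0"
    by blast
qed

end
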